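(* Let $Y$ be a locally compact $\sigma$-compact Hausdorff space and $q:Y\to X$ a pure quotient map with $X$ Hausdorff. Then: (i) If $x\in X$ is a P-point of $X$ then $q$ is locally closed at $x$. (ii) Let $W$ be the set of P-points of the subspace $F_q\cup N_q$ and $V$ the interior of $F_q\cup N_q$ in $X$. Then $V\cap W\subseteq F_q\subseteq W$. (iii) $F_q$ is a P-space and has empty interior in $X$.
   Context: A map $q:Y\to X$ is locally closed at $x\in X$ if for every closed set $W\subseteq Y$, $x\in\overline{q(W)}$ implies $x\in q(W)$. $F_q=\{x\in X: q \text{ is locally closed at } x \text{ and } q^{-1}(x) \text{ has non-compact boundary}\}$; $N_q=\{x\in X: q \text{ is not locally closed at } x\}$. A point $x$ of a Tychonoff space is a P-point if the intersection of any countable family of neighbourhoods of $x$ is a neighbourhood of $x$; a space is a P-space if every point is a P-point. (A Hausdorff quotient of a locally compact $\sigma$-compact Hausdorff space is normal, hence Tychonoff.) A net in $Y$ converges to $\infty$ if it is eventually outside every compact subset of $Y$. A quotient map $q:Y\to X$ (with $Y$ locally compact $\sigma$-compact Hausdorff, $X$ Hausdorff) is pure if there is a subset $D\subseteq Y$ such that (i) $D$ is dense in $Y$ and $q|_D$ is injective, and (ii) for every net $(d_\alpha)$ in $D$ with $d_\alpha\to\infty$, every net $(e_\alpha)$ in $Y$ (with the same index set) satisfying $q(e_\alpha)=q(d_\alpha)$ for all $\alpha$ also satisfies $e_\alpha\to\infty$. *)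

theory Defs
  imports "HOL-Analysis.Analysis"
begin

definition sigma_compact_space :: "'a topology \<Rightarrow> bool" where
  "sigma_compact_space Y \<longleftrightarrow>
     (\<exists>K :: nat \<Rightarrow> 'a set. (\<forall>n. compactin Y (K n)) \<and> (\<Union>n. K n) = topspace Y)"

definition fibre :: "'a topology \<Rightarrow> ('a \<Rightarrow> 'b) \<Rightarrow> 'b \<Rightarrow> 'a set" where
  "fibre Y q x = {y \<in> topspace Y. q y = x}"

definition locally_closed_at :: "'a topology \<Rightarrow> 'b topology \<Rightarrow> ('a \<Rightarrow> 'b) \<Rightarrow> 'b \<Rightarrow> bool" where
  "locally_closed_at Y X q x \<longleftrightarrow>
     x \<in> topspace X \<and> (\<forall>W. closedin Y W \<and> x \<in> X closure_of (q ` W) \<longrightarrow> x \<in> q ` W)"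

definition F_set :: "'a topology \<Rightarrow> 'b topology \<Rightarrow> ('a \<Rightarrow> 'b) \<Rightarrow> 'b set" where
  "F_set Y X q = {x \<in> topspace X. locally_closed_at Y X q x \<and>
                                  \<not> compactin Y (Y frontier_of (fibre Y q x))}"

definition N_set :: "'a topology \<Rightarrow> 'b topology \<Rightarrow> ('a \<Rightarrow> 'b) \<Rightarrow> 'b set" where
  "N_set Y X q = {x \<in> topspace X. \<not> locally_closed_at Y X q x}"

text \<open>A neighbourhood of \<open>x\<close> is a subset of the space having \<open>x\<close> in its interior. The intersection
  is taken inside \<open>topspace X\<close> because \<open>\<Inter>{} = UNIV\<close>.\<close>

definition P_point :: "'a topology \<Rightarrow> 'a \<Rightarrow> bool" where
  "P_point X x \<longleftrightarrow> x \<in> topspace X \<and>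
     (\<forall>\<N>. countable \<N> \<and> (\<forall>N\<in>\<N>. N \<subseteq> topspace X \<and> x \<in> X interior_of N)
        \<longrightarrow> x \<in> X interior_of (topspace X \<inter> \<Inter>\<N>))"

text \<open>The first two conjuncts say that \<open>X\<close> is Tychonoff.\<close>

definition P_space :: "'a topology \<Rightarrow> bool" where
  "P_space X \<longleftrightarrow> Hausdorff_space X \<and> completely_regular_space X \<and> (\<forall>x\<in>topspace X. P_point X x)"

text \<open>A net in a set \<open>S\<close> is a function on a directed set \<open>A\<close> (preordered by \<open>r\<close>) with values in
  \<open>S\<close>; its values outside \<open>A\<close> are irrelevant.\<close>

definition directed_set :: "'i set \<Rightarrow> 'i rel \<Rightarrow> bool" where
  "directed_set A r \<longleftrightarrow> A \<noteq> {} \<and> preorder_on A r \<and>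
     (\<forall>a\<in>A. \<forall>b\<in>A. \<exists>c\<in>A. (a, c) \<in> r \<and> (b, c) \<in> r)"

definition net_to_infinity :: "'a topology \<Rightarrow> 'i set \<Rightarrow> 'i rel \<Rightarrow> ('i \<Rightarrow> 'a) \<Rightarrow> bool" where
  "net_to_infinity Y A r d \<longleftrightarrow>
     (\<forall>K. compactin Y K \<longrightarrow> (\<exists>a\<in>A. \<forall>b\<in>A. (a, b) \<in> r \<longrightarrow> d b \<notin> K))"

text \<open>Condition (ii) of purity for nets whose index sets are drawn from the type \<open>'i\<close>.\<close>

definition pure_nets :: "'i itself \<Rightarrow> 'a topology \<Rightarrow> ('a \<Rightarrow> 'b) \<Rightarrow> 'a set \<Rightarrow> bool" where
  "pure_nets (_ :: 'i itself) Y q D \<longleftrightarrow>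
     (\<forall>(A :: 'i set) r d e.
        directed_set A r \<and> (\<forall>a\<in>A. d a \<in> D) \<and> net_to_infinity Y A r d \<and>
        (\<forall>a\<in>A. e a \<in> topspace Y \<and> q (e a) = q (d a))
        \<longrightarrow> net_to_infinity Y A r e)"

text \<open>A definition cannot quantify over all index types, so index sets are taken in the type
  \<open>'a set\<close>. This loses nothing: by the lemma \<open>pure_nets_any_index_type\<close> below,
  the condition then holds for nets indexed by directed sets of any type.\<close>

definition pure_quotient_map :: "'a topology \<Rightarrow> 'b topology \<Rightarrow> ('a \<Rightarrow> 'b) \<Rightarrow> bool" where
  "pure_quotient_map Y X q \<longleftrightarrow> quotient_map Y X q \<and>
     (\<exists>D \<subseteq> topspace Y. Y closure_of D = topspace Y \<and> inj_on q D \<and>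
        pure_nets TYPE('a set) Y q D)"

lemma pure_nets_any_index_type:
  fixes Y :: "'a topology" and q :: "'a \<Rightarrow> 'b"
  assumes pure: "pure_nets TYPE('a set) Y q D"
  shows "pure_nets TYPE('i) Y q D"
  unfolding pure_nets_def
proof (intro allI impI, elim conjE)
  fix A :: "'i set" and r and d e :: "'i \<Rightarrow> 'a"
  assume dir: "directed_set A r" and dD: "\<forall>a\<in>A. d a \<in> D" and dinf: "net_to_infinity Y A r d"
    and e: "\<forall>a\<in>A. e a \<in> topspace Y \<and> q (e a) = q (d a)"
  show "net_to_infinity Y A r e"
  proof (rule ccontr)
    assume "\<not> net_to_infinity Y A r e"
    then obtain K where K: "compactin Y K"
      and freq: "\<And>a. a \<in> A \<Longrightarrow> \<exists>b\<in>A. (a, b) \<in> r \<and> e b \<in> K"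
      unfolding net_to_infinity_def by blast
    have "\<exists>b\<in>A. d b \<notin> L \<and> e b \<in> K" if "compactin Y L" for L
      using dinf that freq unfolding net_to_infinity_def by meson
    then obtain h where h: "\<And>L. compactin Y L \<Longrightarrow> h L \<in> A \<and> d (h L) \<notin> L \<and> e (h L) \<in> K"
      by metis
    define B where "B = {L. compactin Y L}"
    define s where "s = {(L, M). L \<in> B \<and> M \<in> B \<and> L \<subseteq> M}"
    have "directed_set B s"
      unfolding directed_set_def
    proof (intro conjI ballI)
      show "B \<noteq> {}" using K by (auto simp: B_def)
      show "preorder_on B s"
        by (auto simp: preorder_on_def refl_on_def trans_def s_def)
      fix L M assume "L \<in> B" "M \<in> B"
      then have "L \<union> M \<in> B" by (simp add: B_def compactin_Un)
      with \<open>L \<in> B\<close> \<open>M \<in> B\<close> show "\<exists>N\<in>B. (L, N) \<in> s \<and> (M, N) \<in> s"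
        by (auto simp: s_def)
    qed
    moreover have "net_to_infinity Y B s (\<lambda>L. d (h L))"
      unfolding net_to_infinity_def using h by (force simp: B_def s_def)
    moreover have "\<forall>L\<in>B. d (h L) \<in> D" "\<forall>L\<in>B. e (h L) \<in> topspace Y \<and> q (e (h L)) = q (d (h L))"
      using h dD e by (auto simp: B_def)
    ultimately have "net_to_infinity Y B s (\<lambda>L. e (h L))"
      using pure[unfolded pure_nets_def, rule_format,
          where A = B and r = s and d = "\<lambda>L. d (h L)" and e = "\<lambda>L. e (h L)"] by simp
    then obtain L where L: "L \<in> B" "\<And>M. M \<in> B \<Longrightarrow> (L, M) \<in> s \<Longrightarrow> e (h M) \<notin> K"
      using K unfolding net_to_infinity_def by blast
    then have "e (h L) \<notin> K" by (simp add: s_def)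
    with h L(1) show False by (simp add: B_def)
  qed
qed

end

theory Submission
  imports Defs
begin

text \<open>Exhaust \<open>Y\<close> by open sets \<open>G n\<close> inside compact sets \<open>L n\<close>. At a P-point, a closed \<open>W\<close> is the
  union of countably many \<open>W \<inter> L n\<close> with closed images, so \<open>q\<close> is locally closed there.

  Conversely, let \<open>q\<close> be locally closed at \<open>x\<close> and let \<open>U n\<close> be open neighbourhoods of \<open>x\<close>. The set
  of \<open>y\<close> with \<open>y \<notin> G n\<close> and \<open>q y \<notin> U n\<close> for some \<open>n\<close> is closed, being a locally finite union, so
  some neighbourhood \<open>P\<close> of \<open>x\<close> misses its image: the part of \<open>P\<close> outside \<open>U n\<close> has its preimage in
  the compact set \<open>L n\<close>. But a point with a neighbourhood whose preimage lies in a compact set is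
  neither in \<open>F\<close> nor in \<open>N\<close>, so points of \<open>F \<union> N\<close> in \<open>P\<close> belong to the closure of every \<open>U n\<close>, and
  regularity of \<open>X\<close> removes the closure. (\<open>X\<close> is normal: disjoint closed sets are enlarged step by
  step, the \<open>n\<close>-th step separating them inside the compact set \<open>q ` L n\<close>.)

  Finally, on an open set of P-points the image of a compact set is finite, so the fibres over it
  are open and have empty boundary.\<close>

subsection \<open>P-points\<close>

lemma P_point_in_topspace: "P_point X x \<Longrightarrow> x \<in> topspace X"
  by (simp add: P_point_def)

lemma P_point_iff_sequence:
  "P_point X x \<longleftrightarrow> x \<in> topspace X \<and>
     (\<forall>U :: nat \<Rightarrow> 'a set. (\<forall>n. openin X (U n) \<and> x \<in> U n) \<longrightarrow> x \<in> X interior_of (\<Inter>n. U n))"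
  (is "_ \<longleftrightarrow> _ \<and> ?R")
proof (intro iffI conjI allI impI)
  assume P: "P_point X x"
  then show "x \<in> topspace X" by (rule P_point_in_topspace)
  fix U :: "nat \<Rightarrow> 'a set"
  assume U: "\<forall>n. openin X (U n) \<and> x \<in> U n"
  then have "x \<in> X interior_of (topspace X \<inter> \<Inter>(range U))"
    by (intro P[unfolded P_point_def, THEN conjunct2, rule_format])
      (simp add: image_iff, metis interior_of_openin openin_subset)
  then show "x \<in> X interior_of (\<Inter>n. U n)"
    using interior_of_mono[of "topspace X \<inter> \<Inter>(range U)" "\<Inter>n. U n" X] by blast
next
  assume R: "x \<in> topspace X \<and> ?R"
  show "P_point X x"
    unfolding P_point_def
  proof (intro conjI allI impI R[THEN conjunct1], elim conjE)
    fix \<N> assume N: "countable \<N>" "\<forall>N\<in>\<N>. N \<subseteq> topspace X \<and> x \<in> X interior_of N"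
    \<comment> \<open>Adding \<open>topspace X\<close> makes the enumerated family nonempty, so that
      \<open>from_nat_into\<close> has exactly this family as its range even when
      \<open>\<N>\<close> is empty.\<close>
    define U where "U n = X interior_of (from_nat_into (insert (topspace X) \<N>) n)" for n
    have range: "range (from_nat_into (insert (topspace X) \<N>)) = insert (topspace X) \<N>"
      using N by (simp add: range_from_nat_into)
    have "openin X (U n) \<and> x \<in> U n" for n
    proof -
      have "x \<in> X interior_of (topspace X)" using R by simp
      moreover have "from_nat_into (insert (topspace X) \<N>) n \<in> insert (topspace X) \<N>"
        by (rule from_nat_into) simp
      ultimately have "x \<in> U n" using N(2) unfolding U_def by (metis insert_iff)
      then show ?thesis by (simp add: U_def)
    qed
    then have "x \<in> X interior_of (\<Inter>n. U n)"
      by (intro R[THEN conjunct2, rule_format]) blast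
    moreover have "(\<Inter>n. U n) \<subseteq> topspace X \<inter> \<Inter>\<N>"
    proof -
      have "(\<Inter>n. U n) \<subseteq> M" if "M \<in> insert (topspace X) \<N>" for M
      proof -
        have "M \<in> range (from_nat_into (insert (topspace X) \<N>))"
          using that by (simp only: range)
        then obtain n where "M = from_nat_into (insert (topspace X) \<N>) n"
          by blast
        then have "U n \<subseteq> M" using interior_of_subset[of X M] by (simp add: U_def)
        then show ?thesis by blast
      qed
      then show ?thesis by blast
    qed
    ultimately show "x \<in> X interior_of (topspace X \<inter> \<Inter>\<N>)"
      using interior_of_mono by blast
  qed
qed

text \<open>Relatively open sets are traces of open sets of \<open>X\<close>, so the test can run
  over the latter. This form suits the later use with \<open>S\<close> equal to
  \<open>F \<union> N\<close>, where the neighbourhood \<open>P\<close> is controlled only on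
  \<open>S\<close>.\<close>

lemma P_point_subtopologyI:
  assumes "x \<in> topspace X" "x \<in> S"
    and "\<And>U :: nat \<Rightarrow> 'a set. (\<And>n. openin X (U n) \<and> x \<in> U n) \<Longrightarrow>
           \<exists>P. openin X P \<and> x \<in> P \<and> P \<inter> S \<subseteq> (\<Inter>n. U n)"
  shows "P_point (subtopology X S) x"
  unfolding P_point_iff_sequence
proof (intro conjI allI impI)
  show "x \<in> topspace (subtopology X S)" using assms by simp
  fix U :: "nat \<Rightarrow> 'a set"
  assume "\<forall>n. openin (subtopology X S) (U n) \<and> x \<in> U n"
  then have "\<forall>n. \<exists>T. openin X T \<and> U n = T \<inter> S" "\<And>n. x \<in> U n"
    unfolding openin_subtopology by simp_all
  then obtain T where T: "\<And>n. openin X (T n)" "\<And>n. U n = T n \<inter> S" by metis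
  then have "\<And>n. openin X (T n) \<and> x \<in> T n" using \<open>\<And>n. x \<in> U n\<close> by auto
  then obtain P where P: "openin X P" "x \<in> P" "P \<inter> S \<subseteq> (\<Inter>n. T n)"
    using assms(3)[of T] by blast
  then have "openin (subtopology X S) (P \<inter> S)" "x \<in> P \<inter> S" "P \<inter> S \<subseteq> (\<Inter>n. U n)"
    using T assms by (auto simp: openin_subtopology)
  then show "x \<in> subtopology X S interior_of (\<Inter>n. U n)"
    by (meson interior_of_maximal subsetD)
qed

lemma P_point_subtopologyD:
  fixes U :: "nat \<Rightarrow> 'a set"
  assumes "P_point (subtopology X S) x" and U: "\<And>n. openin X (U n) \<and> x \<in> U n"
  obtains P where "openin X P" "x \<in> P" "P \<inter> S \<subseteq> (\<Inter>n. U n)"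
proof -
  have "x \<in> S" using P_point_in_topspace[OF assms(1)] by simp
  have "\<forall>n. openin (subtopology X S) (U n \<inter> S) \<and> x \<in> U n \<inter> S"
    using U \<open>x \<in> S\<close> unfolding openin_subtopology by blast
  then have "x \<in> subtopology X S interior_of (\<Inter>n. U n \<inter> S)"
    by (intro assms(1)[unfolded P_point_iff_sequence, THEN conjunct2, rule_format]) blast
  then obtain T where "openin (subtopology X S) T" "x \<in> T" "T \<subseteq> (\<Inter>n. U n \<inter> S)"
    unfolding interior_of_def by blast
  then obtain P where "openin X P" "T = P \<inter> S" unfolding openin_subtopology by blast
  with \<open>x \<in> T\<close> \<open>T \<subseteq> _\<close> show thesis by (intro that[of P]) blast+
qed

lemma P_point_subtopology_mono:
  assumes "P_point (subtopology X S) x" "T \<subseteq> S" "x \<in> T"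
  shows "P_point (subtopology X T) x"
proof (rule P_point_subtopologyI)
  show "x \<in> topspace X" "x \<in> T" using assms P_point_in_topspace[OF assms(1)] by auto
  fix U :: "nat \<Rightarrow> 'a set" assume "\<And>n. openin X (U n) \<and> x \<in> U n"
  then obtain P where P: "openin X P" "x \<in> P" "P \<inter> S \<subseteq> (\<Inter>n. U n)"
    by (rule P_point_subtopologyD[OF assms(1)]) (rule that)
  from assms(2) have "P \<inter> T \<subseteq> P \<inter> S" by blast
  with P show "\<exists>P. openin X P \<and> x \<in> P \<and> P \<inter> T \<subseteq> (\<Inter>n. U n)"
    by (meson order_trans)
qed

lemma P_point_of_subtopology:
  assumes P: "P_point (subtopology X S) x" and x: "x \<in> X interior_of S"
  shows "P_point X x"
proof -
  have "P_point (subtopology X (topspace X)) x"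
  proof (rule P_point_subtopologyI)
    show "x \<in> topspace X" "x \<in> topspace X" using P_point_in_topspace[OF P] by auto
    fix U :: "nat \<Rightarrow> 'a set" assume "\<And>n. openin X (U n) \<and> x \<in> U n"
    then obtain Q where "openin X Q" "x \<in> Q" "Q \<inter> S \<subseteq> (\<Inter>n. U n)"
      using P_point_subtopologyD[OF P, of U] by blast
    \<comment> \<open>Cutting \<open>Q\<close> down to the interior of \<open>S\<close> turns
      control on the trace \<open>Q \<inter> S\<close> into control on an open set of
      \<open>X\<close>.\<close>
    then have "openin X (Q \<inter> X interior_of S) \<and> x \<in> Q \<inter> X interior_of S \<and>
        (Q \<inter> X interior_of S) \<inter> topspace X \<subseteq> (\<Inter>n. U n)"
      using x interior_of_subset[of X S] by auto
    then show "\<exists>P. openin X P \<and> x \<in> P \<and> P \<inter> topspace X \<subseteq> (\<Inter>n. U n)" by blast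
  qed
  then show ?thesis by simp
qed

text \<open>An infinite compact set has a countably infinite subset \<open>S\<close> accumulating at
  some point \<open>x\<close> of the compact set. Deleting the other points of \<open>S\<close> one
  at a time gives countably many neighbourhoods of \<open>x\<close> whose intersection is not a
  neighbourhood.\<close>

lemma finite_compactin_P_points:
  assumes t1: "t1_space X" and C: "compactin X C" and P: "\<And>x. x \<in> C \<Longrightarrow> P_point X x"
  shows "finite C"
proof (rule ccontr)
  assume "infinite C"
  then obtain S where S: "S \<subseteq> C" "countable S" "infinite S"
    using infinite_countable_subset' by blast
  then obtain x where x: "x \<in> C" "x \<in> X derived_set_of S"
    using compactin_imp_Bolzano_Weierstrass[OF C] by blast
  define \<N> where "\<N> = (\<lambda>s. topspace X - {s}) ` (S - {x})"
  have "N \<subseteq> topspace X \<and> x \<in> X interior_of N" if "N \<in> \<N>" for N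
  proof -
    have "openin X N" "x \<in> N"
      using that t1 compactin_subset_topspace[OF C] x S
      by (auto simp: \<N>_def t1_space_openin_delete_alt)
    then show ?thesis by (simp add: interior_of_openin openin_subset)
  qed
  moreover have "countable \<N>" using S by (simp add: \<N>_def)
  ultimately have "x \<in> X interior_of (topspace X \<inter> \<Inter>\<N>)"
    by (intro P[OF x(1), unfolded P_point_def, THEN conjunct2, rule_format] conjI ballI) blast+
  then obtain T where T: "openin X T" "x \<in> T" "T \<subseteq> topspace X \<inter> \<Inter>\<N>"
    unfolding interior_of_def by blast
  then obtain s where "s \<noteq> x" "s \<in> S" "s \<in> T"
    using T x(2) unfolding in_derived_set_of by blast
  then have "T \<subseteq> topspace X - {s}" using T(3) unfolding \<N>_def by blast
  with \<open>s \<in> T\<close> show False by blast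
qed

subsection \<open>Quotients of locally compact sigma-compact spaces\<close>

text \<open>Each point has an open neighbourhood \<open>G m\<close> contained in all later
  \<open>G n\<close>. This yields common indices and local finiteness below, while
  \<open>L n\<close> supplies the compactness.\<close>

lemma locally_compact_sigma_compact_exhaustion:
  assumes "locally_compact_space Y" "sigma_compact_space Y" "Hausdorff_space Y"
  obtains G L :: "nat \<Rightarrow> 'a set"
  where "\<And>n. openin Y (G n)" "\<And>n. G n \<subseteq> L n" "incseq G" "(\<Union>n. G n) = topspace Y"
    "\<And>n. compactin Y (L n)"
proof -
  obtain K :: "nat \<Rightarrow> 'a set" where K: "\<And>n. compactin Y (K n)" "(\<Union>n. K n) = topspace Y"
    using assms(2) unfolding sigma_compact_space_def by blast
  have "\<forall>n. \<exists>U L. openin Y U \<and> compactin Y L \<and> K n \<subseteq> U \<and> U \<subseteq> L"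
    using locally_compact_space_compact_closed_compact[of Y] assms(1,3) K(1) by meson
  then obtain U L where UL: "\<And>n. openin Y (U n)" "\<And>n. compactin Y (L n)"
      "\<And>n. K n \<subseteq> U n" "\<And>n. U n \<subseteq> L n"
    by metis
  show thesis
  proof
    show "openin Y (\<Union>i\<le>n. U i)" for n using UL by blast
    show "compactin Y (\<Union>i\<le>n. L i)" for n using UL by (intro compactin_Union) auto
    show "(\<Union>i\<le>n. U i) \<subseteq> (\<Union>i\<le>n. L i)" for n by (rule UN_mono[OF order_refl UL(4)])
    show "incseq (\<lambda>n. \<Union>i\<le>n. U i)"
      by (intro incseq_SucI UN_mono; simp)
    have "topspace Y \<subseteq> (\<Union>n. U n)"       unfolding K(2)[symmetric] by (rule UN_mono[OF order_refl UL(3)])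
    also have "\<dots> \<subseteq> (\<Union>n. \<Union>i\<le>n. U i)" by blast
    finally show "(\<Union>n. \<Union>i\<le>n. U i) = topspace Y"
      using openin_subset[OF UL(1)] by blast
  qed
qed

text \<open>This is one step of the proof of normality. \<open>C\<close> and \<open>E\<close> are
  again closed and disjoint, so the step can be repeated; they surround \<open>A\<close> and
  \<open>B\<close> only relative to \<open>K\<close>. They come from a Urysohn function on the
  normal subspace \<open>K\<close>.\<close>

lemma Hausdorff_space_separate_in_compact:
  assumes X: "Hausdorff_space X" and K: "compactin X K"
    and AB: "closedin X A" "closedin X B" "disjnt A B"
  obtains C E G H where "closedin X C" "closedin X E" "A \<subseteq> C" "B \<subseteq> E" "disjnt C E"
    "openin X G" "openin X H" "A \<inter> K \<subseteq> G" "G \<inter> K \<subseteq> C" "B \<inter> K \<subseteq> H" "H \<inter> K \<subseteq> E"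
proof -
  let ?Z = "subtopology X K"
  have top: "topspace ?Z = K" using K compactin_subset_topspace by fastforce
  have Kc: "closedin X K" using X K compactin_imp_closedin by blast
  have "normal_space ?Z"
    using X K by (simp add: compact_Hausdorff_or_regular_imp_normal_space
        compact_space_subtopology Hausdorff_space_subtopology)
  moreover have "closedin ?Z (A \<inter> K)" "closedin ?Z (B \<inter> K)" "disjnt (A \<inter> K) (B \<inter> K)"
    using AB by (auto simp: closedin_subtopology disjnt_def)
  ultimately obtain f where f: "continuous_map ?Z euclideanreal f"
    "f ` (A \<inter> K) \<subseteq> {0}" "f ` (B \<inter> K) \<subseteq> {1}"
    unfolding normal_space_iff_Urysohn_alt by meson
  \<comment> \<open>The weak inequalities give closed sets; the strict ones used for
    \<open>G\<close> and \<open>H\<close> give relatively open sets inside them that still contain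
    \<open>A \<inter> K\<close> and \<open>B \<inter> K\<close>.\<close>
  define C where "C = {x \<in> topspace ?Z. f x \<in> {..1/3}}"
  define E where "E = {x \<in> topspace ?Z. f x \<in> {2/3..}}"
  have "closedin ?Z C" "closedin ?Z E"
    unfolding C_def E_def by (rule closedin_continuous_map_preimage[OF f(1)]; simp)+
  then have CE: "closedin X C" "closedin X E"
    by (auto intro: closedin_trans_full[OF _ Kc])
  have "openin ?Z {x \<in> topspace ?Z. f x \<in> {..<1/3}}" "openin ?Z {x \<in> topspace ?Z. f x \<in> {2/3<..}}"
    by (rule openin_continuous_map_preimage[OF f(1)]; simp)+
  then obtain G H where G: "openin X G" "{x \<in> topspace ?Z. f x \<in> {..<1/3}} = G \<inter> K"
    and H: "openin X H" "{x \<in> topspace ?Z. f x \<in> {2/3<..}} = H \<inter> K"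
    unfolding openin_subtopology by blast
  have f0: "f x = 0" if "x \<in> A" "x \<in> K" for x using f(2) that by blast
  have f1: "f x = 1" if "x \<in> B" "x \<in> K" for x using f(3) that by blast
  show thesis
  proof
    \<comment> \<open>The parts of \<open>A\<close> and \<open>B\<close> outside \<open>K\<close>
      are put back. They create no new intersection, because \<open>C\<close> and \<open>E\<close>
      lie in \<open>K\<close>, where \<open>f\<close> is 0 on \<open>A\<close> and 1 on
      \<open>B\<close>.\<close>
    show "closedin X (A \<union> C)" "closedin X (B \<union> E)" using AB CE by auto
    show "disjnt (A \<union> C) (B \<union> E)"
      using AB(3) f0 f1 by (fastforce simp: disjnt_iff C_def E_def)
    have "x \<in> G \<inter> K" if "x \<in> A \<inter> K" for x
      unfolding G(2)[symmetric] using that f0[of x] compactin_subset_topspace[OF K] by auto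
    then show "A \<inter> K \<subseteq> G" by blast
    have "x \<in> H \<inter> K" if "x \<in> B \<inter> K" for x
      unfolding H(2)[symmetric] using that f1[of x] compactin_subset_topspace[OF K] by auto
    then show "B \<inter> K \<subseteq> H" by blast
    show "G \<inter> K \<subseteq> A \<union> C" "H \<inter> K \<subseteq> B \<union> E"
      unfolding G(2)[symmetric] H(2)[symmetric] by (auto simp: C_def E_def)
  qed (use G H in auto)
qed

text \<open>Openness is tested on the preimage in \<open>Y\<close>. Points of \<open>G k\<close>
  have their values in the image of \<open>L k\<close>, so control of \<open>P\<close> on that image
  is enough. The shift from \<open>A k\<close> to \<open>A (Suc k)\<close> is absorbed by the
  union.\<close>

lemma quotient_openin_of_exhaustion:
  assumes q: "quotient_map Y X q"
    and G: "\<And>n. openin Y (G n)" "\<And>n. G n \<subseteq> L n" "incseq G" "(\<Union>n. G n) = topspace Y"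
    and A: "incseq A" "\<And>n :: nat. A n \<subseteq> topspace X"
    and O: "\<And>n. \<exists>P. openin X P \<and> A n \<inter> q ` L n \<subseteq> P \<and> P \<inter> q ` L n \<subseteq> A (Suc n)"
  shows "openin X (\<Union>n. A n)"
proof -
  have "openin Y {y \<in> topspace Y. q y \<in> (\<Union>n. A n)}"
  proof (subst openin_subopen, clarify)
    fix y n assume y: "y \<in> topspace Y" "q y \<in> A n"
    obtain m where "y \<in> G m" using y G by blast
    \<comment> \<open>Both sequences increase, so the larger of the two indices serves for
      both.\<close>
    then obtain k where k: "y \<in> G k" "q y \<in> A k"
      using y(2) \<open>incseq G\<close> \<open>incseq A\<close> by (meson incseqD max.cobounded1 max.cobounded2 subsetD)
    obtain P where P: "openin X P" "A k \<inter> q ` L k \<subseteq> P" "P \<inter> q ` L k \<subseteq> A (Suc k)"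
      using O by blast
    have "openin Y {y \<in> topspace Y. q y \<in> P}"
      using q P(1) openin_continuous_map_preimage quotient_imp_continuous_map by blast
    then have "openin Y (G k \<inter> {y \<in> topspace Y. q y \<in> P})" using G(1) by blast
    moreover have "y \<in> G k \<inter> {y \<in> topspace Y. q y \<in> P}"
      using k y(1) P(2) G(2) by blast
    moreover have "G k \<inter> {y \<in> topspace Y. q y \<in> P} \<subseteq> {y \<in> topspace Y. q y \<in> (\<Union>n. A n)}"
      using P(3) G(2) by blast
    ultimately show "\<exists>T. openin Y T \<and> y \<in> T \<and> T \<subseteq> {y \<in> topspace Y. q y \<in> (\<Union>n. A n)}"
      by blast
  qed
  moreover have "(\<Union>n. A n) \<subseteq> topspace X" using A by blast
  ultimately show ?thesis using q unfolding quotient_map_def by blast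
qed

lemma normal_space_quotient_sigma_compact:
  assumes Y: "locally_compact_space Y" "sigma_compact_space Y" "Hausdorff_space Y"
    and X: "Hausdorff_space X" and q: "quotient_map Y X q"
  shows "normal_space X"
  unfolding normal_space_def
proof (intro allI impI, elim conjE)
  fix A B assume AB: "closedin X A" "closedin X B" "disjnt A B"
  obtain G L :: "nat \<Rightarrow> 'a set" where G: "\<And>n. openin Y (G n)" "\<And>n. G n \<subseteq> L n" "incseq G"
      "(\<Union>n. G n) = topspace Y" and L: "\<And>n. compactin Y (L n)"
    using locally_compact_sigma_compact_exhaustion[OF Y] by metis
  have qL: "compactin X (q ` L n)" for n
    using L q image_compactin quotient_imp_continuous_map by blast
  \<comment> \<open>Stage \<open>n\<close> gains room only inside the compact image of
    \<open>L n\<close>; since the \<open>G n\<close> exhaust \<open>Y\<close>, this makes the union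
    of all stages open.\<close>
  define R where "R n S T \<longleftrightarrow> S \<subseteq> T \<and> (\<exists>P. openin X P \<and> S \<inter> q ` L n \<subseteq> P \<and> P \<inter> q ` L n \<subseteq> T)"
    for n and S T
  \<comment> \<open>The two sides are chosen together as a pair, because each enlargement has to
    stay disjoint from the other.\<close>
  have "\<exists>f. \<forall>n. (closedin X (fst (f n)) \<and> closedin X (snd (f n)) \<and> disjnt (fst (f n)) (snd (f n)) \<and>
      A \<subseteq> fst (f n) \<and> B \<subseteq> snd (f n)) \<and>
      (R n (fst (f n)) (fst (f (Suc n))) \<and> R n (snd (f n)) (snd (f (Suc n))))"
  proof (rule dependent_nat_choice)
    show "\<exists>p. closedin X (fst p) \<and> closedin X (snd p) \<and> disjnt (fst p) (snd p) \<and>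
        A \<subseteq> fst p \<and> B \<subseteq> snd p"
      using AB by (intro exI[of _ "(A, B)"]) simp
  next
    fix p n
    assume p: "closedin X (fst p) \<and> closedin X (snd p) \<and> disjnt (fst p) (snd p) \<and>
        A \<subseteq> fst p \<and> B \<subseteq> snd p"
    then obtain C E P Q where CE: "closedin X C" "closedin X E" "fst p \<subseteq> C" "snd p \<subseteq> E" "disjnt C E"
      and PQ: "openin X P" "openin X Q" "fst p \<inter> q ` L n \<subseteq> P" "P \<inter> q ` L n \<subseteq> C"
        "snd p \<inter> q ` L n \<subseteq> Q" "Q \<inter> q ` L n \<subseteq> E"
      using Hausdorff_space_separate_in_compact[OF X qL, of "fst p" "snd p" n] by metis
    then have "R n (fst p) C \<and> R n (snd p) E" unfolding R_def by blast
    then show "\<exists>p'. (closedin X (fst p') \<and> closedin X (snd p') \<and> disjnt (fst p') (snd p') \<and>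
        A \<subseteq> fst p' \<and> B \<subseteq> snd p') \<and> R n (fst p) (fst p') \<and> R n (snd p) (snd p')"
      using CE p by (intro exI[of _ "(C, E)"]) (simp, blast)
  qed
  then obtain f where fR: "\<forall>n. (closedin X (fst (f n)) \<and> closedin X (snd (f n)) \<and>
      disjnt (fst (f n)) (snd (f n)) \<and> A \<subseteq> fst (f n) \<and> B \<subseteq> snd (f n)) \<and>
      (R n (fst (f n)) (fst (f (Suc n))) \<and> R n (snd (f n)) (snd (f (Suc n))))" ..
  then have f: "\<And>n. closedin X (fst (f n))" "\<And>n. closedin X (snd (f n))"
      "\<And>n. disjnt (fst (f n)) (snd (f n))" "\<And>n. A \<subseteq> fst (f n)" "\<And>n. B \<subseteq> snd (f n)"
      and R: "\<And>n. R n (fst (f n)) (fst (f (Suc n)))" "\<And>n. R n (snd (f n)) (snd (f (Suc n)))"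
    by simp_all
  have inc: "incseq (\<lambda>n. fst (f n))" "incseq (\<lambda>n. snd (f n))"
    by (rule incseq_SucI, use R in \<open>simp add: R_def\<close>)+
  have "openin X (\<Union>n. fst (f n))"
    using q G inc(1)
    by (rule quotient_openin_of_exhaustion) (use f R in \<open>simp_all add: R_def closedin_subset\<close>)
  moreover have "openin X (\<Union>n. snd (f n))"
    using q G inc(2)
    by (rule quotient_openin_of_exhaustion) (use f R in \<open>simp_all add: R_def closedin_subset\<close>)
  moreover have "disjnt (\<Union>n. fst (f n)) (\<Union>n. snd (f n))"
    unfolding disjnt_iff
  proof clarify
    fix z m n assume "z \<in> fst (f m)" "z \<in> snd (f n)"
    then have "z \<in> fst (f (max m n))" "z \<in> snd (f (max m n))"
      using inc by (meson incseqD max.cobounded1 max.cobounded2 subsetD)+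
    then show False using f(3)[of "max m n"] by (simp add: disjnt_iff)
  qed
  ultimately show "\<exists>U V. openin X U \<and> openin X V \<and> A \<subseteq> U \<and> B \<subseteq> V \<and> disjnt U V"
    using f(4)[of 0] f(5)[of 0] by blast
qed

subsection \<open>Local closedness\<close>

lemma locally_closed_at_P_point:
  assumes Y: "sigma_compact_space Y" and X: "Hausdorff_space X" and q: "continuous_map Y X q"
    and x: "P_point X x"
  shows "locally_closed_at Y X q x"
  unfolding locally_closed_at_def
proof (intro conjI allI impI P_point_in_topspace[OF x], elim conjE, rule ccontr)
  fix W assume W: "closedin Y W" "x \<in> X closure_of (q ` W)" "x \<notin> q ` W"
  obtain K :: "nat \<Rightarrow> 'a set" where K: "\<And>n. compactin Y (K n)" "(\<Union>n. K n) = topspace Y"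
    using Y unfolding sigma_compact_space_def by blast
  \<comment> \<open>Images of the compact pieces \<open>W \<inter> K n\<close> are closed and miss
    \<open>x\<close>. The pieces cover \<open>W\<close>, so the intersection of the
    \<open>U n\<close> misses the image of \<open>W\<close>.\<close>
  define U where "U n = topspace X - q ` (W \<inter> K n)" for n
  have "openin X (U n) \<and> x \<in> U n" for n
  proof -
    have "compactin X (q ` (W \<inter> K n))"
      using W(1) K(1) q image_compactin closed_Int_compactin by blast
    then show ?thesis
      using compactin_imp_closedin[OF X] W(3) P_point_in_topspace[OF x] unfolding U_def by blast
  qed
  then have "x \<in> X interior_of (\<Inter>n. U n)"
    by (intro x[unfolded P_point_iff_sequence, THEN conjunct2, rule_format]) blast
  then obtain T where "openin X T" "x \<in> T" "T \<subseteq> (\<Inter>n. U n)"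
    unfolding interior_of_def by blast
  moreover obtain w where "w \<in> W" "q w \<in> T"
    using calculation W(2) unfolding in_closure_of by blast
  moreover have "w \<in> topspace Y" using calculation W(1) closedin_subset by blast
  moreover have "\<exists>n. w \<in> K n" using \<open>w \<in> topspace Y\<close> K(2) by blast
  ultimately show False by (auto simp: U_def)
qed

text \<open>Over \<open>P\<close>, a closed set \<open>W\<close> can be replaced by its compact part
  \<open>W \<inter> K\<close>, whose image is closed in the Hausdorff space \<open>X\<close>. The
  fibre of \<open>z\<close> lies in \<open>K\<close> as well, so its boundary is compact.\<close>

lemma not_in_F_N_if_preimage_in_compact:
  assumes X: "Hausdorff_space X" and q: "continuous_map Y X q"
    and P: "openin X P" "z \<in> P" and K: "compactin Y K" "{y \<in> topspace Y. q y \<in> P} \<subseteq> K"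
  shows "z \<notin> F_set Y X q \<union> N_set Y X q"
proof -
  have z: "z \<in> topspace X" using P openin_subset by blast
  have "locally_closed_at Y X q z"
    unfolding locally_closed_at_def
  proof (intro conjI allI impI z, elim conjE)
    fix W assume W: "closedin Y W" "z \<in> X closure_of (q ` W)"
    have "compactin X (q ` (W \<inter> K))"
      using W(1) K(1) q image_compactin closed_Int_compactin by blast
    then have "closedin X (q ` (W \<inter> K))" using X compactin_imp_closedin by blast
    moreover have "z \<in> X closure_of (q ` (W \<inter> K))"
      unfolding in_closure_of
    proof (intro conjI allI impI z, elim conjE)
      fix T assume T: "z \<in> T" "openin X T"
      then have "z \<in> T \<inter> P" "openin X (T \<inter> P)" using P by auto
      then obtain w where w: "w \<in> W" "q w \<in> T \<inter> P"
        using W(2) unfolding in_closure_of by (metis imageE)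
      then have "w \<in> K" using K(2) closedin_subset[OF W(1)] by blast
      then show "\<exists>y. y \<in> q ` (W \<inter> K) \<and> y \<in> T" using w by blast
    qed
    ultimately show "z \<in> q ` W" using closure_of_closedin by blast
  qed
  moreover have "compactin Y (Y frontier_of (fibre Y q z))"
  proof -
    have "closedin X {z}" using X z closedin_Hausdorff_singleton by metis
    then have "closedin Y {y \<in> topspace Y. q y \<in> {z}}"
      using q closedin_continuous_map_preimage by blast
    then have cl: "closedin Y (fibre Y q z)" by (simp add: fibre_def)
    then have "Y frontier_of (fibre Y q z) \<subseteq> fibre Y q z" by (simp add: frontier_of_subset_closedin)
    also have "\<dots> \<subseteq> K" using K P by (auto simp: fibre_def)
    finally show ?thesis using K(1) closed_compactin closedin_frontier_of by metis
  qed
  ultimately show ?thesis by (simp add: F_set_def N_set_def)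
qed

lemma P_point_subtopology_F_N:
  assumes Y: "locally_compact_space Y" "sigma_compact_space Y" "Hausdorff_space Y"
    and X: "Hausdorff_space X" and q: "quotient_map Y X q"
    and x: "x \<in> F_set Y X q"
  shows "P_point (subtopology X (F_set Y X q \<union> N_set Y X q)) x"
proof (rule P_point_subtopologyI)
  have lc: "locally_closed_at Y X q x" using x by (simp add: F_set_def)
  show xX: "x \<in> topspace X" and "x \<in> F_set Y X q \<union> N_set Y X q" using x by (auto simp: F_set_def)
  have qc: "continuous_map Y X q" using q quotient_imp_continuous_map by blast
  obtain G L :: "nat \<Rightarrow> 'a set" where G: "\<And>n. openin Y (G n)" "\<And>n. G n \<subseteq> L n" "incseq G"
      "(\<Union>n. G n) = topspace Y" and L: "\<And>n. compactin Y (L n)"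
    using locally_compact_sigma_compact_exhaustion[OF Y] by metis
  have "normal_space X" using normal_space_quotient_sigma_compact[OF Y X q] .
  then have "regular_space X"
    using X completely_regular_imp_regular_space normal_imp_completely_regular_space by blast
  fix U :: "nat \<Rightarrow> 'b set" assume U: "\<And>n. openin X (U n) \<and> x \<in> U n"
  \<comment> \<open>Two sets per index are used: \<open>T n\<close> being open makes
    \<open>W n\<close> closed, and \<open>C n\<close> being closed makes the part of
    \<open>P\<close> outside it open.\<close>
  have "\<forall>n. \<exists>T C. openin X T \<and> closedin X C \<and> x \<in> T \<and> T \<subseteq> C \<and> C \<subseteq> U n"
    using U \<open>regular_space X\<close> unfolding neighbourhood_base_of_closedin[symmetric] neighbourhood_base_of
    by metis
  then obtain T C where T: "\<And>n. openin X (T n)" "\<And>n. x \<in> T n"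
    and C: "\<And>n. closedin X (C n)" "\<And>n. T n \<subseteq> C n" "\<And>n. C n \<subseteq> U n"
    by metis
  define W where "W n = (topspace Y - G n) \<inter> {y \<in> topspace Y. q y \<in> topspace X - T n}" for n
  have "closedin Y (\<Union>(range W))"
  proof (rule closedin_locally_finite_Union)
    fix S assume "S \<in> range W"
    then obtain n where "S = W n" by blast
    moreover have "closedin Y {y \<in> topspace Y. q y \<in> topspace X - T n}"
      using qc T(1)[of n] closedin_continuous_map_preimage by blast
    ultimately show "closedin Y S" using G(1)[of n] by (auto simp: W_def)
  next
    show "locally_finite_in Y (range W)"
      unfolding locally_finite_in_def
    proof (intro conjI ballI)
      show "\<Union>(range W) \<subseteq> topspace Y" by (auto simp: W_def)
      fix y assume "y \<in> topspace Y"
      then obtain m where m: "y \<in> G m" using G by blast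
      \<comment> \<open>\<open>W n\<close> avoids \<open>G n\<close>, which contains
        \<open>G m\<close> when \<open>m \<le> n\<close>, so only indices below \<open>m\<close>
        remain.\<close>
      have "{S \<in> range W. S \<inter> G m \<noteq> {}} \<subseteq> W ` {..<m}"
      proof clarify
        fix n assume "W n \<inter> G m \<noteq> {}"
        then have "\<not> m \<le> n" using incseqD[OF G(3), of m n] by (auto simp: W_def)
        then show "W n \<in> W ` {..<m}" by simp
      qed
      then have "finite {S \<in> range W. S \<inter> G m \<noteq> {}}" using finite_subset by blast
      then show "\<exists>V. openin Y V \<and> y \<in> V \<and> finite {S \<in> range W. S \<inter> V \<noteq> {}}"
        using m G(1) by blast
    qed
  qed
  moreover have "x \<notin> q ` \<Union>(range W)" using T by (auto simp: W_def)
  ultimately have "x \<notin> X closure_of (q ` \<Union>(range W))"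
    using lc unfolding locally_closed_at_def by blast
  then obtain P where P: "openin X P" "x \<in> P" "\<And>w. w \<in> \<Union>(range W) \<Longrightarrow> q w \<notin> P"
    using xX unfolding in_closure_of by blast
  have "z \<in> U n" if z: "z \<in> P" "z \<in> F_set Y X q \<union> N_set Y X q" for z n
  proof (rule ccontr)
    assume "z \<notin> U n"
    then have "z \<in> P \<inter> (topspace X - C n)"
      using C(3)[of n] z(1) openin_subset[OF P(1)] by blast
    moreover have "openin X (P \<inter> (topspace X - C n))"
      using P(1) C(1)[of n] by blast
    \<comment> \<open>A point \<open>y\<close> of this preimage outside \<open>G n\<close> would
      have \<open>q y\<close> outside \<open>T n\<close>, hence lie in \<open>W n\<close>, and then
      \<open>q y\<close> could not be in \<open>P\<close>.\<close>
    moreover have "{y \<in> topspace Y. q y \<in> P \<inter> (topspace X - C n)} \<subseteq> L n"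
      using P(3) G(2)[of n] C(2)[of n] by (fastforce simp: W_def)
    ultimately show False
      using not_in_F_N_if_preimage_in_compact[OF X qc _ _ L] z(2) by blast
  qed
  then show "\<exists>P. openin X P \<and> x \<in> P \<and> P \<inter> (F_set Y X q \<union> N_set Y X q) \<subseteq> (\<Inter>n. U n)"
    using P by blast
qed

text \<open>A compact neighbourhood of a point of the fibre, taken over \<open>O'\<close>, has a
  finite image. Removing the closed preimage of the finitely many values other than \<open>x\<close>
  leaves a neighbourhood inside the fibre.\<close>

lemma openin_fibre_of_P_points:
  assumes Y: "locally_compact_space Y" "Hausdorff_space Y"
    and X: "Hausdorff_space X" and q: "continuous_map Y X q"
    and O: "openin X O'" "x \<in> O'" "\<And>z. z \<in> O' \<Longrightarrow> P_point X z"
  shows "openin Y (fibre Y q x)"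
proof (subst openin_subopen, intro ballI)
  fix y assume y: "y \<in> fibre Y q x"
  have "openin Y {y \<in> topspace Y. q y \<in> O'}"
    using q O(1) openin_continuous_map_preimage by blast
  moreover have "y \<in> {y \<in> topspace Y. q y \<in> O'}" using y O(2) by (simp add: fibre_def)
  moreover have "neighbourhood_base_of (compactin Y) Y"
    using Y locally_compact_space_neighbourhood_base by blast
  ultimately obtain V C where VC: "openin Y V" "compactin Y C" "y \<in> V" "V \<subseteq> C"
      "C \<subseteq> {y \<in> topspace Y. q y \<in> O'}"
    unfolding neighbourhood_base_of by meson
  have "compactin X (q ` C)" using VC q image_compactin by blast
  then have "finite (q ` C)"
    using VC O X by (intro finite_compactin_P_points[of X]) (auto simp: Hausdorff_imp_t1_space)
  moreover have "q ` C - {x} \<subseteq> topspace X" using VC(5) openin_subset[OF O(1)] by blast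
  ultimately have "closedin X (q ` C - {x})"
    using X by (simp add: closedin_Hausdorff_finite)
  then have "closedin Y {y \<in> topspace Y. q y \<in> q ` C - {x}}"
    using q closedin_continuous_map_preimage by blast
  then have "openin Y (V - {y \<in> topspace Y. q y \<in> q ` C - {x}})" using VC(1) by blast
  moreover have "y \<in> V - {y \<in> topspace Y. q y \<in> q ` C - {x}}"
    using y VC by (simp add: fibre_def)
  moreover have "V - {y \<in> topspace Y. q y \<in> q ` C - {x}} \<subseteq> fibre Y q x"
    using VC by (auto simp: fibre_def)
  ultimately show "\<exists>T. openin Y T \<and> y \<in> T \<and> T \<subseteq> fibre Y q x" by blast
qed

section \<open>Deduction of the three statements\<close>

theorem theorem4p5:
  fixes Y :: "'a topology" and X :: "'b topology" and q :: "'a \<Rightarrow> 'b"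
  assumes "locally_compact_space Y" and "sigma_compact_space Y" and "Hausdorff_space Y"
    and "Hausdorff_space X"
    and "pure_quotient_map Y X q"
  defines "F \<equiv> F_set Y X q" and "N \<equiv> N_set Y X q"
  defines "W \<equiv> {x. P_point (subtopology X (F \<union> N)) x}"
    and "V \<equiv> X interior_of (F \<union> N)"
  shows "(\<forall>x. P_point X x \<longrightarrow> locally_closed_at Y X q x) \<and>
         (V \<inter> W \<subseteq> F \<and> F \<subseteq> W) \<and>
         (P_space (subtopology X F) \<and> X interior_of F = {})"
proof -
  note Y = assms(1-3) and X = assms(4)
  have q: "quotient_map Y X q" using assms(5) by (simp add: pure_quotient_map_def)
  then have qc: "continuous_map Y X q" by (rule quotient_imp_continuous_map)
  have lc: "locally_closed_at Y X q x" if "P_point X x" for x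
    using locally_closed_at_P_point[OF Y(2) X qc that] .
  have FW: "F \<subseteq> W"
    using P_point_subtopology_F_N[OF Y X q] by (auto simp: W_def F_def N_def)
  \<comment> \<open>A P-point of \<open>F \<union> N\<close> in the interior of that set is a
    P-point of \<open>X\<close>, so local closedness excludes it from \<open>N\<close>.\<close>
  have VW: "V \<inter> W \<subseteq> F"
  proof
    fix x assume x: "x \<in> V \<inter> W"
    then have "locally_closed_at Y X q x"
      using P_point_of_subtopology[of X "F \<union> N" x] lc by (auto simp: V_def W_def)
    moreover have "x \<in> F \<union> N" using x interior_of_subset[of X "F \<union> N"] by (auto simp: V_def)
    ultimately show "x \<in> F" by (auto simp: N_def N_set_def)
  qed
  have FP: "P_point (subtopology X F) x" if "x \<in> F" for x
    using that FW P_point_subtopology_mono[of X "F \<union> N" x F] by (auto simp: W_def)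
  \<comment> \<open>Complete regularity, unlike normality, passes to every subspace.\<close>
  have "completely_regular_space X"
    using X normal_space_quotient_sigma_compact[OF Y X q] normal_imp_completely_regular_space
    by blast
  then have "P_space (subtopology X F)"
    using X FP by (simp add: P_space_def Hausdorff_space_subtopology
        completely_regular_space_subtopology)
  moreover have "X interior_of F = {}"
  proof (rule ccontr)
    assume "X interior_of F \<noteq> {}"
    then obtain x where x: "x \<in> X interior_of F" by blast
    then have xF: "x \<in> F" using interior_of_subset by (metis subsetD)
    \<comment> \<open>The interior of \<open>F\<close> is thus an open set of P-points of
      \<open>X\<close>. The fibre of \<open>x\<close> is then clopen with empty, hence compact,
      boundary, which contradicts \<open>x \<in> F\<close>.\<close>
    have "P_point X z" if "z \<in> X interior_of F" for z
      using that FP interior_of_subset[of X F] P_point_of_subtopology[of X F z] by blast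
    then have "openin Y (fibre Y q x)"
      using openin_fibre_of_P_points[OF Y(1,3) X qc openin_interior_of x] by blast
    moreover have "closedin Y (fibre Y q x)"
    proof -
      have "closedin X {x}"
        using X xF by (simp add: F_def F_set_def closedin_Hausdorff_singleton)
      then have "closedin Y {y \<in> topspace Y. q y \<in> {x}}"
        using qc closedin_continuous_map_preimage by blast
      then show ?thesis by (simp add: fibre_def)
    qed
    ultimately have "Y frontier_of (fibre Y q x) = {}"
      by (simp add: frontier_of_def closure_of_closedin interior_of_openin)
    then show False using xF by (simp add: F_def F_set_def)
  qed
  ultimately show ?thesis using lc VW FW by blast
qed

end
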